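(* Let $K$ be a field and $E$ a row-finite graph, let $e_0\in E^1$ be an edge, and let $n$ be a positive integer. Define $v_0=r_E(e_0)$. Then $$L_K(E(v_0,n))\cong L_K(E(e_0,n))$$ as $K$-algebras.
   Context: A (directed) graph $E=(E^0,E^1,s,r)$ consists of two disjoint sets $E^0$ (vertices) and $E^1$ (edges) and maps $s=s_E,r=r_E:E^1\to E^0$ (source and range). It is row-finite if $|s^{-1}(v)|<\infty$ for all $v\in E^0$. A vertex $v$ is regular if $0<|s^{-1}(v)|<\infty$. For a vertex $v_0\in E^0$ and a positive integer $n$, the graph $E(v_0,n)$ has vertices $E^0\cup\{v_1,\dots,v_n\}$ and edges $E^1\cup\{e_1,\dots,e_n\}$ (all the $v_i$, $e_i$ with $i\ge 1$ being new), with source and range maps extending those of $E$ and with $s(e_i)=v_i$, $r(e_i)=v_{i-1}$ for $1\le i\le n$. For an edge $e_0\in E^1$ and a positive integer $n$, the graph $E(e_0,n)$ has vertices $E^0\cup\{v_1,\dots,v_n\}$ and edges $(E^1\setminus\{e_0\})\cup\{e_1,\dots,e_{n+1}\}$ (all the $v_i$, $e_i$ with $i\ge 1$ being new), with source and range maps extending those of $E$ on $E^1\setminus\{e_0\}$ and with $r(e_i)=v_{i-1}$ for $2\le i\le n+1$, $s(e_i)=v_i$ for $1\le i\le n$, $r(e_1)=r_E(e_0)$ and $s(e_{n+1})=s_E(e_0)$. For a field $K$, the Leavitt path algebra $L_K(E)$ is the (associative, not necessarily unital if $E^0$ is infinite) $K$-algebra generated by $\{v,e,e^*\mid v\in E^0,e\in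 E^1\}$ subject to, for all $v,w\in E^0$, $e,f\in E^1$: (1) $vw=\delta_{v,w}w$; (2) $s(e)e=e=e\,r(e)$ and $r(e)e^*=e^*=e^*s(e)$; (3) $e^*f=\delta_{e,f}r(e)$; (4) $v=\sum_{e\in s^{-1}(v)}ee^*$ for every regular vertex $v$. *)

theory Defs
  imports "HOL-Library.Poly_Mapping" "Graph_Theory.Digraph"
begin

text \<open>
  A graph is a record \<open>E :: ('v, 'e) pre_digraph\<close> with \<open>wf_digraph E\<close>: vertices \<open>verts E\<close>,
  edges \<open>arcs E\<close>, source \<open>tail E\<close> and range \<open>head E\<close>, so that the fibre of the source map
  over \<open>v\<close> is \<open>out_arcs E v\<close>. Infinitely many vertices and edges, loops and parallel edges
  are allowed; vertices and edges are disjoint because they have different types.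
\<close>

definition row_finite :: "('v, 'e) pre_digraph \<Rightarrow> bool" where
  "row_finite E \<longleftrightarrow> (\<forall>v \<in> verts E. finite (out_arcs E v))"

definition regular :: "('v, 'e) pre_digraph \<Rightarrow> 'v \<Rightarrow> bool" where
  "regular E v \<longleftrightarrow> v \<in> verts E \<and> out_arcs E v \<noteq> {} \<and> finite (out_arcs E v)"

text \<open>
  In the next two graphs \<open>Inl\<close> embeds the old vertices and edges, while \<open>Inr i\<close> is the new
  vertex \<open>v\<^sub>i\<close> or the new edge \<open>e\<^sub>i\<close> (\<open>i \<ge> 1\<close>). As \<open>v\<^sub>0\<close> is an old vertex, it is not \<open>Inr 0\<close>.
\<close>

definition chain_vertex :: "'v \<Rightarrow> nat \<Rightarrow> 'v + nat" where
  "chain_vertex v0 i = (if i = 0 then Inl v0 else Inr i)"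

definition vertex_extension ::
    "('v, 'e) pre_digraph \<Rightarrow> 'v \<Rightarrow> nat \<Rightarrow> ('v + nat, 'e + nat) pre_digraph" where
  "vertex_extension E v0 n =
    \<lparr> verts = Inl ` verts E \<union> Inr ` {1..n},
      arcs = Inl ` arcs E \<union> Inr ` {1..n},
      tail = case_sum (\<lambda>e. Inl (tail E e)) (chain_vertex v0),
      head = case_sum (\<lambda>e. Inl (head E e)) (\<lambda>i. chain_vertex v0 (i - 1)) \<rparr>"

definition edge_extension ::
    "('v, 'e) pre_digraph \<Rightarrow> 'e \<Rightarrow> nat \<Rightarrow> ('v + nat, 'e + nat) pre_digraph" where
  "edge_extension E e0 n =
    \<lparr> verts = Inl ` verts E \<union> Inr ` {1..n},
      arcs = Inl ` (arcs E - {e0}) \<union> Inr ` {1..n + 1},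
      tail = case_sum (\<lambda>e. Inl (tail E e))
        (\<lambda>i. if i = n + 1 then Inl (tail E e0) else Inr i),
      head = case_sum (\<lambda>e. Inl (head E e))
        (\<lambda>i. if i = 1 then Inl (head E e0) else Inr (i - 1)) \<rparr>"

text \<open>
  The free monoid, written additively because monomials are added in \<open>Poly_Mapping\<close>; hence
  \<open>'g word \<Rightarrow>\<^sub>0 'k\<close> is the unital free associative algebra on \<open>'g\<close>.
\<close>

datatype 'g word = Word (letters: "'g list")

instantiation word :: (type) monoid_add
begin

definition zero_word :: "'a word" where
  "0 = Word []"

definition plus_word :: "'a word \<Rightarrow> 'a word \<Rightarrow> 'a word" where
  "u + w = Word (letters u @ letters w)"

instance
  by standard (simp_all add: zero_word_def plus_word_def)

end

definition scale :: "'k::field \<Rightarrow> ('g word \<Rightarrow>\<^sub>0 'k) \<Rightarrow> ('g word \<Rightarrow>\<^sub>0 'k)" where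
  "scale c p = Poly_Mapping.map (\<lambda>x. c * x) p"

definition gen :: "'g \<Rightarrow> ('g word \<Rightarrow>\<^sub>0 'k::field)" where
  "gen x = Poly_Mapping.single (Word [x]) 1"

text \<open>
  The non-unital free algebra on \<open>X\<close>: the empty word, which is the unit, is excluded.
\<close>

definition free_algebra :: "'g set \<Rightarrow> ('g word \<Rightarrow>\<^sub>0 'k::field) set" where
  "free_algebra X = {p. \<forall>w \<in> Poly_Mapping.keys p. letters w \<noteq> [] \<and> set (letters w) \<subseteq> X}"

inductive_set gen_ideal ::
    "('g word \<Rightarrow>\<^sub>0 'k::field) set \<Rightarrow> ('g word \<Rightarrow>\<^sub>0 'k) set \<Rightarrow> ('g word \<Rightarrow>\<^sub>0 'k) set"
  for F R where
  zero: "0 \<in> gen_ideal F R"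
| incl: "r \<in> R \<Longrightarrow> r \<in> gen_ideal F R"
| add: "p \<in> gen_ideal F R \<Longrightarrow> q \<in> gen_ideal F R \<Longrightarrow> p + q \<in> gen_ideal F R"
| scale: "p \<in> gen_ideal F R \<Longrightarrow> scale c p \<in> gen_ideal F R"
| left: "a \<in> F \<Longrightarrow> p \<in> gen_ideal F R \<Longrightarrow> a * p \<in> gen_ideal F R"
| right: "a \<in> F \<Longrightarrow> p \<in> gen_ideal F R \<Longrightarrow> p * a \<in> gen_ideal F R"

text \<open>
  The rings and algebras of \<open>HOL-Algebra\<close> are unital; Leavitt path algebras need not be.
\<close>

record ('k, 'a) nonunital_algebra =
  alg_carrier :: "'a set"
  alg_add :: "'a \<Rightarrow> 'a \<Rightarrow> 'a"
  alg_mult :: "'a \<Rightarrow> 'a \<Rightarrow> 'a"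
  alg_scale :: "'k \<Rightarrow> 'a \<Rightarrow> 'a"

definition alg_iso ::
    "('k, 'a) nonunital_algebra \<Rightarrow> ('k, 'b) nonunital_algebra \<Rightarrow> ('a \<Rightarrow> 'b) \<Rightarrow> bool" where
  "alg_iso A B h \<longleftrightarrow>
    bij_betw h (alg_carrier A) (alg_carrier B) \<and>
    (\<forall>x \<in> alg_carrier A. \<forall>y \<in> alg_carrier A.
      h (alg_add A x y) = alg_add B (h x) (h y) \<and>
      h (alg_mult A x y) = alg_mult B (h x) (h y)) \<and>
    (\<forall>c. \<forall>x \<in> alg_carrier A. h (alg_scale A c x) = alg_scale B c (h x))"

definition alg_isomorphic ::
    "('k, 'a) nonunital_algebra \<Rightarrow> ('k, 'b) nonunital_algebra \<Rightarrow> bool" where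
  "alg_isomorphic A B \<longleftrightarrow> (\<exists>h. alg_iso A B h)"

definition rel_cong ::
    "'g set \<Rightarrow> ('g word \<Rightarrow>\<^sub>0 'k::field) set \<Rightarrow> (('g word \<Rightarrow>\<^sub>0 'k) \<times> ('g word \<Rightarrow>\<^sub>0 'k)) set" where
  "rel_cong X R = {(p, q). p \<in> free_algebra X \<and> q \<in> free_algebra X \<and>
    p - q \<in> gen_ideal (free_algebra X) R}"

text \<open>
  The non-unital algebra generated by \<open>X\<close> subject to \<open>r = 0\<close> for all \<open>r \<in> R\<close>: the residue
  classes of the free algebra modulo the ideal generated by \<open>R\<close>. All classes united in an
  operation coincide; see \<open>presented_algebra_add\<close> and the two lemmas after it.
\<close>

definition presented_algebra ::
    "'g set \<Rightarrow> ('g word \<Rightarrow>\<^sub>0 'k::field) set \<Rightarrow> ('k, ('g word \<Rightarrow>\<^sub>0 'k) set) nonunital_algebra" where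
  "presented_algebra X R =
    \<lparr> alg_carrier = free_algebra X // rel_cong X R,
      alg_add = (\<lambda>A B. \<Union>p \<in> A. \<Union>q \<in> B. rel_cong X R `` {p + q}),
      alg_mult = (\<lambda>A B. \<Union>p \<in> A. \<Union>q \<in> B. rel_cong X R `` {p * q}),
      alg_scale = (\<lambda>c A. \<Union>p \<in> A. rel_cong X R `` {scale c p}) \<rparr>"

datatype ('v, 'e) lpa_gen = Vertex 'v | Edge 'e | Ghost 'e

definition lpa_gens :: "('v, 'e) pre_digraph \<Rightarrow> ('v, 'e) lpa_gen set" where
  "lpa_gens E = Vertex ` verts E \<union> Edge ` arcs E \<union> Ghost ` arcs E"

definition lpa_rels :: "('v, 'e) pre_digraph \<Rightarrow> (('v, 'e) lpa_gen word \<Rightarrow>\<^sub>0 'k::field) set" where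
  "lpa_rels E =
    {gen (Vertex v) * gen (Vertex w) - (if v = w then gen (Vertex w) else 0) | v w.
      v \<in> verts E \<and> w \<in> verts E} \<union>
    {gen (Vertex (tail E e)) * gen (Edge e) - gen (Edge e) | e. e \<in> arcs E} \<union>
    {gen (Edge e) * gen (Vertex (head E e)) - gen (Edge e) | e. e \<in> arcs E} \<union>
    {gen (Vertex (head E e)) * gen (Ghost e) - gen (Ghost e) | e. e \<in> arcs E} \<union>
    {gen (Ghost e) * gen (Vertex (tail E e)) - gen (Ghost e) | e. e \<in> arcs E} \<union>
    {gen (Ghost e) * gen (Edge f) - (if e = f then gen (Vertex (head E e)) else 0) | e f.
      e \<in> arcs E \<and> f \<in> arcs E} \<union>
    {gen (Vertex v) - (\<Sum>e \<in> out_arcs E v. gen (Edge e) * gen (Ghost e)) | v. regular E v}"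

text \<open>The field \<open>K\<close> is the type \<open>'k\<close>, passed as a type token.\<close>

definition leavitt_path_algebra ::
    "'k::field itself \<Rightarrow> ('v, 'e) pre_digraph \<Rightarrow>
      ('k, (('v, 'e) lpa_gen word \<Rightarrow>\<^sub>0 'k) set) nonunital_algebra" where
  "leavitt_path_algebra K E = presented_algebra (lpa_gens E) (lpa_rels E)"

lemma lookup_scale: "Poly_Mapping.lookup (scale c p) w = c * Poly_Mapping.lookup p w"
  by (simp add: scale_def Poly_Mapping.map.rep_eq when_def)

lemma free_algebra_add:
  "p \<in> free_algebra X \<Longrightarrow> q \<in> free_algebra X \<Longrightarrow> p + q \<in> free_algebra X"
  using Poly_Mapping.keys_add[of p q] by (fastforce simp: free_algebra_def)

lemma free_algebra_mult:
  "p \<in> free_algebra X \<Longrightarrow> q \<in> free_algebra X \<Longrightarrow> p * q \<in> free_algebra X"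
  using keys_mult[of p q] by (fastforce simp: free_algebra_def plus_word_def)

lemma free_algebra_scale: "p \<in> free_algebra X \<Longrightarrow> scale c p \<in> free_algebra X"
  by (auto simp: free_algebra_def in_keys_iff lookup_scale)

lemma gen_ideal_uminus: "p \<in> gen_ideal F R \<Longrightarrow> - p \<in> gen_ideal F R"
proof -
  assume "p \<in> gen_ideal F R"
  then have "scale (- 1) p \<in> gen_ideal F R"
    by (rule gen_ideal.scale)
  moreover have "scale (- 1) p = - p"
    by (rule poly_mapping_eqI) (simp add: lookup_scale)
  ultimately show ?thesis by simp
qed

lemma equiv_rel_cong: "equiv (free_algebra X) (rel_cong X R)"
proof (rule equivI)
  show "rel_cong X R \<subseteq> free_algebra X \<times> free_algebra X"
    by (auto simp: rel_cong_def)
  show "refl_on (free_algebra X) (rel_cong X R)"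
    by (auto simp: rel_cong_def refl_on_def gen_ideal.zero)
  show "sym (rel_cong X R)"
    by (rule symI) (use gen_ideal_uminus in \<open>fastforce simp: rel_cong_def\<close>)
  show "trans (rel_cong X R)"
    by (rule transI) (use gen_ideal.add in \<open>fastforce simp: rel_cong_def\<close>)
qed

lemma rel_cong_add:
  assumes "(p, p') \<in> rel_cong X R" "(q, q') \<in> rel_cong X R"
  shows "(p + q, p' + q') \<in> rel_cong X R"
proof -
  have "(p - p') + (q - q') \<in> gen_ideal (free_algebra X) R"
    using assms by (intro gen_ideal.add) (auto simp: rel_cong_def)
  then have "(p + q) - (p' + q') \<in> gen_ideal (free_algebra X) R"
    by (simp only: add_diff_add)
  then show ?thesis
    using assms by (simp add: rel_cong_def free_algebra_add)
qed

lemma rel_cong_mult: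
  assumes "(p, p') \<in> rel_cong X R" "(q, q') \<in> rel_cong X R"
  shows "(p * q, p' * q') \<in> rel_cong X R"
proof -
  have "p * q - p' * q' = p * (q - q') + (p - p') * q'" by (simp add: algebra_simps)
  with assms show ?thesis
    unfolding rel_cong_def
    by (auto intro: free_algebra_mult gen_ideal.add gen_ideal.left gen_ideal.right)
qed

lemma rel_cong_scale:
  assumes "(p, p') \<in> rel_cong X R"
  shows "(scale c p, scale c p') \<in> rel_cong X R"
proof -
  have "scale c p - scale c p' = scale c (p - p')" 
    by (rule poly_mapping_eqI) (simp add: lookup_scale lookup_minus algebra_simps)
  with assms show ?thesis
    unfolding rel_cong_def by (auto intro: free_algebra_scale gen_ideal.scale)
qed

lemma presented_algebra_add:
  assumes "p \<in> free_algebra X" "q \<in> free_algebra X"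
  shows "alg_add (presented_algebra X R) (rel_cong X R `` {p}) (rel_cong X R `` {q})
    = rel_cong X R `` {p + q}"
proof -
  have "congruent2 (rel_cong X R) (rel_cong X R) (\<lambda>p q. rel_cong X R `` {p + q})"
    by (auto simp: congruent2_def intro!: equiv_class_eq[OF equiv_rel_cong] rel_cong_add)
  from UN_equiv_class2[OF equiv_rel_cong equiv_rel_cong this assms] show ?thesis
    by (simp add: presented_algebra_def)
qed

lemma presented_algebra_mult:
  assumes "p \<in> free_algebra X" "q \<in> free_algebra X"
  shows "alg_mult (presented_algebra X R) (rel_cong X R `` {p}) (rel_cong X R `` {q})
    = rel_cong X R `` {p * q}"
proof -
  have "congruent2 (rel_cong X R) (rel_cong X R) (\<lambda>p q. rel_cong X R `` {p * q})"
    by (auto simp: congruent2_def intro!: equiv_class_eq[OF equiv_rel_cong] rel_cong_mult)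
  from UN_equiv_class2[OF equiv_rel_cong equiv_rel_cong this assms] show ?thesis
    by (simp add: presented_algebra_def)
qed

lemma presented_algebra_scale:
  assumes "p \<in> free_algebra X"
  shows "alg_scale (presented_algebra X R) c (rel_cong X R `` {p})
    = rel_cong X R `` {scale c p}"
proof -
  have "congruent (rel_cong X R) (\<lambda>p. rel_cong X R `` {scale c p})"
    by (auto simp: congruent_def intro!: equiv_class_eq[OF equiv_rel_cong] rel_cong_scale)
  from UN_equiv_class[OF equiv_rel_cong this assms] show ?thesis
    by (simp add: presented_algebra_def)
qed

end

theory Submission
  imports Defs
begin

text \<open>
  In \<open>E(v\<^sub>0, n)\<close> and in \<open>E(e\<^sub>0, n)\<close> alike the vertex \<open>v\<^sub>i\<close> emits only \<open>e\<^sub>i\<close> for \<open>1 \<le> i \<le> n\<close>, so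
  \<open>p = e\<^sub>n \<dots> e\<^sub>1\<close> and \<open>q = e\<^sub>1\<^sup>* \<dots> e\<^sub>n\<^sup>*\<close> satisfy \<open>p q = v\<^sub>n\<close> and \<open>q p = v\<^sub>0\<close> in both algebras. The two
  graphs differ only in one edge: \<open>e\<^sub>0\<close>, which ends in \<open>v\<^sub>0\<close>, is traded for \<open>e\<^bsub>n+1\<^esub>\<close>, which has the
  same source and ends in \<open>v\<^sub>n\<close>. Hence \<open>e\<^sub>0 \<mapsto> e\<^bsub>n+1\<^esub> p\<close>, \<open>e\<^sub>0\<^sup>* \<mapsto> q e\<^bsub>n+1\<^esub>\<^sup>*\<close> defines a homomorphism with
  inverse \<open>e\<^bsub>n+1\<^esub> \<mapsto> e\<^sub>0 q\<close>, \<open>e\<^bsub>n+1\<^esub>\<^sup>* \<mapsto> p e\<^sub>0\<^sup>*\<close>, all other generators being fixed.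
\<close>

subsection \<open>Substitution homomorphisms\<close>

text \<open>Updating at a fresh key is adding a monomial, so additive claims reduce to
  monomials.\<close>

lemma poly_mapping_add_induct [case_names zero single add]:
  assumes "P 0" "\<And>w c. P (Poly_Mapping.single w c)" "\<And>p q. P p \<Longrightarrow> P q \<Longrightarrow> P (p + q)"
  shows "P p"
proof (induction p rule: update_induct)
  case (update p w d)
  have "Poly_Mapping.update w d p = p + Poly_Mapping.single w d"
    using update(1) by (intro poly_mapping_eqI)
      (auto simp: lookup_update lookup_add lookup_single when_def in_keys_iff)
  then show ?case
    using update assms by simp
qed (use assms in simp)

text \<open>The word \<open>0\<close> is the empty one, so scalars are constants inside the unital
  free algebra and the module laws become ring laws.\<close>

lemma scale_eq_mult: "scale c p = Poly_Mapping.single 0 c * p"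
  by (simp add: scale_def mult_map_scale_conv_mult)

lemma scale_single: "scale c (Poly_Mapping.single w d) = Poly_Mapping.single w (c * d)"
  by (simp add: scale_eq_mult mult_single)

text \<open>Constants are central although words do not commute: the empty word is neutral on both
  sides and the coefficients lie in a field.\<close>

lemma mult_scale_right: "p * scale c q = scale c (p * q)"
proof -
  have "p * Poly_Mapping.single 0 c = Poly_Mapping.single 0 c * p"
    by (induction p rule: poly_mapping_add_induct)
      (simp_all add: algebra_simps mult_single mult.commute)
  then show ?thesis
    by (simp add: scale_eq_mult flip: mult.assoc)
qed

lemma mult_scale_left: "scale c p * q = scale c (p * q)"
  by (simp add: scale_eq_mult mult.assoc)

lemma scale_add_left: "scale (c + d) p = scale c p + scale d p"
  by (simp add: scale_eq_mult single_add distrib_right)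

lemma scale_add_right: "scale c (p + q) = scale c p + scale c q"
  by (simp add: scale_eq_mult distrib_left)

lemma scale_zero_left [simp]: "scale 0 p = 0"
  by (simp add: scale_eq_mult)

lemma scale_zero_right [simp]: "scale c 0 = 0"
  by (simp add: scale_eq_mult)

lemma scale_one [simp]: "scale 1 p = p"
  by (simp add: scale_eq_mult)

lemma scale_scale: "scale c (scale d p) = scale (c * d) p"
  by (rule poly_mapping_eqI) (simp add: lookup_scale)

text \<open>The homomorphism given by the universal property of the free algebra. It lives on the
  unital algebra, with the empty word going to 1, so that its laws need no membership
  conditions.\<close>

definition subst ::
    "('g \<Rightarrow> ('h word \<Rightarrow>\<^sub>0 'k::field)) \<Rightarrow> ('g word \<Rightarrow>\<^sub>0 'k) \<Rightarrow> ('h word \<Rightarrow>\<^sub>0 'k)" where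
  "subst \<sigma> p = (\<Sum>w \<in> Poly_Mapping.keys p.
    scale (Poly_Mapping.lookup p w) (prod_list (map \<sigma> (letters w))))"

text \<open>A larger index set only adds zero terms; this allows a common index set for
  \<open>p\<close>, \<open>q\<close> and \<open>p + q\<close>.\<close>

lemma subst_eq_sum:
  assumes "finite W" "Poly_Mapping.keys p \<subseteq> W"
  shows "subst \<sigma> p = (\<Sum>w \<in> W. scale (Poly_Mapping.lookup p w) (prod_list (map \<sigma> (letters w))))"
  unfolding subst_def using assms by (intro sum.mono_neutral_left) (auto simp: in_keys_iff)

lemma subst_single:
  "subst \<sigma> (Poly_Mapping.single w c) = scale c (prod_list (map \<sigma> (letters w)))"
  by (subst subst_eq_sum[of "{w}"]) auto

lemma subst_zero [simp]: "subst \<sigma> 0 = 0"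
  by (simp add: subst_def)

lemma subst_gen [simp]: "subst \<sigma> (gen x) = \<sigma> x"
  by (simp add: gen_def subst_single)

lemma subst_add: "subst \<sigma> (p + q) = subst \<sigma> p + subst \<sigma> q"
  using Poly_Mapping.keys_add[of p q]
  by (simp add: subst_eq_sum[of "Poly_Mapping.keys p \<union> Poly_Mapping.keys q"]
      lookup_add scale_add_left sum.distrib)

lemma subst_scale: "subst \<sigma> (scale c p) = scale c (subst \<sigma> p)"
  by (induction p rule: poly_mapping_add_induct)
    (simp_all add: scale_single subst_single scale_scale scale_add_right subst_add)

lemma subst_diff: "subst \<sigma> (p - q) = subst \<sigma> p - subst \<sigma> q"
  using subst_add[of \<sigma> "p - q" q] by simp

lemma subst_sum: "subst \<sigma> (\<Sum>i \<in> I. p i) = (\<Sum>i \<in> I. subst \<sigma> (p i))"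
  by (induction I rule: infinite_finite_induct) (simp_all add: subst_add)

lemma subst_mult: "subst \<sigma> (p * q) = subst \<sigma> p * subst \<sigma> q"
proof (induction p rule: poly_mapping_add_induct)
  case (single w c)
  show ?case
    by (induction q rule: poly_mapping_add_induct)
      (simp_all add: mult_single subst_single plus_word_def subst_add distrib_left
        mult_scale_left mult_scale_right scale_scale mult.commute)
qed (simp_all add: subst_add distrib_right)

section \<open>The non-unital free algebra and its ideals\<close>

lemma free_algebra_zero [simp]: "0 \<in> free_algebra X"
  by (simp add: free_algebra_def)

lemma free_algebra_gen [simp]: "gen x \<in> free_algebra X \<longleftrightarrow> x \<in> X"
  by (simp add: free_algebra_def gen_def)

lemma free_algebra_mono: "X \<subseteq> Y \<Longrightarrow> free_algebra X \<subseteq> free_algebra Y"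
  by (auto simp: free_algebra_def)

lemma free_algebra_sum:
  "(\<And>i. i \<in> I \<Longrightarrow> p i \<in> free_algebra X) \<Longrightarrow> (\<Sum>i \<in> I. p i) \<in> free_algebra X"
  by (induction I rule: infinite_finite_induct) (simp_all add: free_algebra_add)

text \<open>The non-unital free algebra is spanned by nonempty words, and these are products of
  letters, so there is no case for the unit.\<close>

lemma free_algebra_induct [consumes 1, case_names zero gen add scale mult]:
  fixes p :: "'g word \<Rightarrow>\<^sub>0 'k::field"
  assumes "p \<in> free_algebra X"
    and zero: "P 0"
    and gen: "\<And>x. x \<in> X \<Longrightarrow> P (gen x)"
    and add: "\<And>p q. p \<in> free_algebra X \<Longrightarrow> q \<in> free_algebra X \<Longrightarrow> P p \<Longrightarrow> P q \<Longrightarrow> P (p + q)"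
    and scale: "\<And>c p. p \<in> free_algebra X \<Longrightarrow> P p \<Longrightarrow> P (scale c p)"
    and mult: "\<And>p q. p \<in> free_algebra X \<Longrightarrow> q \<in> free_algebra X \<Longrightarrow> P p \<Longrightarrow> P q \<Longrightarrow> P (p * q)"
  shows "P p"
proof -
  \<comment> \<open>Membership is carried along because the case \<open>mult\<close> asks for
    it.\<close>
  have word: "Poly_Mapping.single (Word l) (1::'k) \<in> free_algebra X \<and>
      P (Poly_Mapping.single (Word l) 1)"
    if "l \<noteq> []" "set l \<subseteq> X" for l
    using that
  proof (induction l rule: list_nonempty_induct)
    case (single x)
    then show ?case
      using gen[of x] free_algebra_gen[of x X] by (auto simp: gen_def)
  next
    case (cons x l)
    have "Poly_Mapping.single (Word (x # l)) 1 = gen x * Poly_Mapping.single (Word l) (1::'k)"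
      by (simp add: gen_def mult_single plus_word_def)
    with cons gen show ?case
      by (simp add: mult free_algebra_mult)
  qed
  from assms(1) show ?thesis
  proof (induction p rule: update_induct)
    case (update p w d)
    have eq: "Poly_Mapping.update w d p = p + scale d (Poly_Mapping.single w 1)"
      using update(1) by (intro poly_mapping_eqI)
        (auto simp: lookup_update lookup_add lookup_single scale_single when_def in_keys_iff)
    \<comment> \<open>As \<open>d\<close> is nonzero, \<open>w\<close> really enters the support, so
      it is a nonempty word over \<open>X\<close>.\<close>
    have "Poly_Mapping.keys (Poly_Mapping.update w d p) = insert w (Poly_Mapping.keys p)"
      using update(2) by (auto simp: in_keys_iff lookup_update split: if_splits)
    with update.prems have "p \<in> free_algebra X" "letters w \<noteq> []" "set (letters w) \<subseteq> X"
      by (auto simp: free_algebra_def)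
    with update.IH word[of "letters w"] show ?case
      unfolding eq by (auto intro!: add scale free_algebra_scale)
  qed (use zero in simp)
qed

lemma subst_in_free_algebra:
  assumes "p \<in> free_algebra X" "\<And>x. x \<in> X \<Longrightarrow> \<sigma> x \<in> free_algebra Y"
  shows "subst \<sigma> p \<in> free_algebra Y"
  using assms(1)
  by (induction p rule: free_algebra_induct)
    (simp_all add: assms(2) subst_add subst_scale subst_mult
      free_algebra_add free_algebra_scale free_algebra_mult)

lemma subst_fixes:
  assumes "p \<in> free_algebra X" "\<And>x. x \<in> X \<Longrightarrow> \<sigma> x = gen x"
  shows "subst \<sigma> p = p"
  using assms(1)
  by (induction p rule: free_algebra_induct)
    (simp_all add: assms(2) subst_add subst_scale subst_mult)

text \<open>The preimage of an ideal under a homomorphism is an ideal, so only the generating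
  relations need checking.\<close>

lemma subst_gen_ideal:
  assumes "p \<in> gen_ideal (free_algebra X) R"
    and "\<And>x. x \<in> X \<Longrightarrow> \<sigma> x \<in> free_algebra Y"
    and "\<And>r. r \<in> R \<Longrightarrow> subst \<sigma> r \<in> gen_ideal (free_algebra Y) S"
  shows "subst \<sigma> p \<in> gen_ideal (free_algebra Y) S"
  using assms(1)
  by induction (auto simp: subst_add subst_scale subst_mult
      intro: gen_ideal.intros assms subst_in_free_algebra)

lemma rel_cong_refl: "p \<in> free_algebra X \<Longrightarrow> (p, p) \<in> rel_cong X R"
  by (simp add: rel_cong_def gen_ideal.zero)

text \<open>The elements fixed modulo the congruence are closed under the algebra operations, so
  generators suffice. With \<open>subst_subst\<close> this recognises a composite of two
  substitutions as the identity of the quotient.\<close>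

lemma subst_rel_cong_self:
  assumes "p \<in> free_algebra X" "\<And>x. x \<in> X \<Longrightarrow> (\<rho> x, gen x) \<in> rel_cong X R"
  shows "(subst \<rho> p, p) \<in> rel_cong X R"
  using assms(1)
  by (induction p rule: free_algebra_induct)
    (auto simp: assms(2) subst_add subst_scale subst_mult
      intro: rel_cong_refl rel_cong_add rel_cong_scale rel_cong_mult)

lemma subst_subst: "subst \<tau> (subst \<sigma> p) = subst (subst \<tau> \<circ> \<sigma>) p"
proof -
  have "subst \<tau> (prod_list (map \<sigma> l)) = prod_list (map (subst \<tau> \<circ> \<sigma>) l)" for l
  proof (induction l)
    case Nil
    have "subst \<tau> 1 = 1"
      by (simp add: subst_single zero_word_def flip: single_one)
    then show ?case by simp
  qed (simp add: subst_mult)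
  then show ?thesis
    by (induction p rule: poly_mapping_add_induct)
      (simp_all add: subst_single subst_add subst_scale)
qed

text \<open>Assignments that respect the relations descend to homomorphisms of the quotients; being
  mutually inverse can be tested on generators.\<close>

theorem presented_algebra_isomorphic:
  fixes R :: "('g word \<Rightarrow>\<^sub>0 'k::field) set" and S :: "('h word \<Rightarrow>\<^sub>0 'k) set"
  assumes \<sigma>: "\<And>x. x \<in> X \<Longrightarrow> \<sigma> x \<in> free_algebra Y"
    and \<tau>: "\<And>y. y \<in> Y \<Longrightarrow> \<tau> y \<in> free_algebra X"
    and R: "\<And>r. r \<in> R \<Longrightarrow> subst \<sigma> r \<in> gen_ideal (free_algebra Y) S"
    and S: "\<And>s. s \<in> S \<Longrightarrow> subst \<tau> s \<in> gen_ideal (free_algebra X) R"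
    and \<tau>\<sigma>: "\<And>x. x \<in> X \<Longrightarrow> (subst \<tau> (\<sigma> x), gen x) \<in> rel_cong X R"
    and \<sigma>\<tau>: "\<And>y. y \<in> Y \<Longrightarrow> (subst \<sigma> (\<tau> y), gen y) \<in> rel_cong Y S"
  shows "alg_isomorphic (presented_algebra X R) (presented_algebra Y S)"
proof -
  let ?c = "\<lambda>p. rel_cong X R `` {p}" and ?d = "\<lambda>q. rel_cong Y S `` {q}"
  \<comment> \<open>All classes united here coincide, since \<open>subst \<sigma>\<close> respects
    the congruences; \<open>h\<close> is the induced map.\<close>
  define h where "h A = (\<Union>p \<in> A. ?d (subst \<sigma> p))" for A
  have subst_\<sigma>: "subst \<sigma> p \<in> free_algebra Y" if "p \<in> free_algebra X" for p
    using that \<sigma> by (rule subst_in_free_algebra)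
  have subst_\<tau>: "subst \<tau> q \<in> free_algebra X" if "q \<in> free_algebra Y" for q
    using that \<tau> by (rule subst_in_free_algebra)
  have cong_\<sigma>: "(subst \<sigma> p, subst \<sigma> p') \<in> rel_cong Y S" if "(p, p') \<in> rel_cong X R" for p p'
    using that subst_gen_ideal[OF _ \<sigma> R, of "p - p'"]
    by (auto simp: rel_cong_def subst_diff subst_\<sigma>)
  have cong_\<tau>: "(subst \<tau> q, subst \<tau> q') \<in> rel_cong X R" if "(q, q') \<in> rel_cong Y S" for q q'
    using that subst_gen_ideal[OF _ \<tau> S, of "q - q'"]
    by (auto simp: rel_cong_def subst_diff subst_\<tau>)
  have inv_\<tau>\<sigma>: "(subst \<tau> (subst \<sigma> p), p) \<in> rel_cong X R" if "p \<in> free_algebra X" for p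
    using that \<tau>\<sigma> unfolding subst_subst by (intro subst_rel_cong_self) auto
  have inv_\<sigma>\<tau>: "(subst \<sigma> (subst \<tau> q), q) \<in> rel_cong Y S" if "q \<in> free_algebra Y" for q
    using that \<sigma>\<tau> unfolding subst_subst by (intro subst_rel_cong_self) auto
  note eqX = equiv_rel_cong[of X R] and eqY = equiv_rel_cong[of Y S]
  have h: "h (?c p) = ?d (subst \<sigma> p)" if "p \<in> free_algebra X" for p
    unfolding h_def
    by (rule UN_equiv_class[OF eqX _ that], rule congruentI)
      (rule equiv_class_eq[OF eqY cong_\<sigma>])
  have carrier: "alg_carrier (presented_algebra X R) = ?c ` free_algebra X"
    "alg_carrier (presented_algebra Y S) = ?d ` free_algebra Y"
    by (auto simp: presented_algebra_def quotient_def)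
  have "inj_on h (?c ` free_algebra X)"
  proof (rule inj_onI, clarify)
    fix p p' assume pp: "p \<in> free_algebra X" "p' \<in> free_algebra X" "h (?c p) = h (?c p')"
    then have "(subst \<sigma> p, subst \<sigma> p') \<in> rel_cong Y S"
      using eq_equiv_class[OF _ eqY] by (simp add: h subst_\<sigma>)
    \<comment> \<open>Applying \<open>\<tau>\<close> brings both elements back to \<open>p\<close>
      and \<open>p'\<close> up to congruence.\<close>
    then have "(subst \<tau> (subst \<sigma> p), subst \<tau> (subst \<sigma> p')) \<in> rel_cong X R"
      by (rule cong_\<tau>)
    then have "(p, p') \<in> rel_cong X R"
      using inv_\<tau>\<sigma>[OF pp(1)] inv_\<tau>\<sigma>[OF pp(2)] eqX by (meson equivE symD transD)
    then show "?c p = ?c p'"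
      by (rule equiv_class_eq[OF eqX])
  qed
  moreover have "h ` ?c ` free_algebra X = ?d ` free_algebra Y"
  proof
    show "h ` ?c ` free_algebra X \<subseteq> ?d ` free_algebra Y"
      by (auto simp: h subst_\<sigma>)
    show "?d ` free_algebra Y \<subseteq> h ` ?c ` free_algebra X"
    proof clarify
      fix q :: "'h word \<Rightarrow>\<^sub>0 'k" assume q: "q \<in> free_algebra Y"
      then have "?d q = h (?c (subst \<tau> q))"
        using equiv_class_eq[OF eqY inv_\<sigma>\<tau>[OF q]] by (simp add: h subst_\<tau>)
      with q show "?d q \<in> h ` ?c ` free_algebra X"
        by (blast intro: subst_\<tau>)
    qed
  qed
  ultimately have "alg_iso (presented_algebra X R) (presented_algebra Y S) h"
    by (auto simp: alg_iso_def carrier bij_betw_def presented_algebra_add presented_algebra_mult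
        presented_algebra_scale h subst_\<sigma> subst_add subst_mult subst_scale
        free_algebra_add free_algebra_mult free_algebra_scale)
  then show ?thesis
    unfolding alg_isomorphic_def by blast
qed


subsection \<open>Computing in Leavitt path algebras\<close>

text \<open>Equality in the Leavitt path algebra of \<open>G\<close>, expressed on representatives.
  It includes membership of both sides in the free algebra, whence the side conditions of the rules
  below.\<close>

definition lpa_eq ::
    "(('v, 'e) lpa_gen word \<Rightarrow>\<^sub>0 'k::field) \<Rightarrow> ('v, 'e) pre_digraph \<Rightarrow>
      (('v, 'e) lpa_gen word \<Rightarrow>\<^sub>0 'k) \<Rightarrow> bool" ("(_/ \<approx>\<^bsub>_\<^esub> _)" [51, 0, 51] 50) where
  "p \<approx>\<^bsub>G\<^esub> q \<longleftrightarrow> (p, q) \<in> rel_cong (lpa_gens G) (lpa_rels G)"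

abbreviation "lpa_free G \<equiv> free_algebra (lpa_gens G)"
abbreviation "vert v \<equiv> gen (Vertex v)"
abbreviation "edge e \<equiv> gen (Edge e)"
abbreviation "ghost e \<equiv> gen (Ghost e)"

lemma lpa_eq_refl: "p \<in> lpa_free G \<Longrightarrow> p \<approx>\<^bsub>G\<^esub> p"
  by (simp add: lpa_eq_def rel_cong_refl)

lemma lpa_eq_trans [trans]: "p \<approx>\<^bsub>G\<^esub> q \<Longrightarrow> q \<approx>\<^bsub>G\<^esub> r \<Longrightarrow> p \<approx>\<^bsub>G\<^esub> r"
  unfolding lpa_eq_def by (meson equivE equiv_rel_cong transD)

lemma lpa_eq_sym: "p \<approx>\<^bsub>G\<^esub> q \<Longrightarrow> q \<approx>\<^bsub>G\<^esub> p"
  unfolding lpa_eq_def by (meson equivE equiv_rel_cong symD)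

lemma lpa_eq_free: "p \<approx>\<^bsub>G\<^esub> q \<Longrightarrow> p \<in> lpa_free G" "p \<approx>\<^bsub>G\<^esub> q \<Longrightarrow> q \<in> lpa_free G"
  by (simp_all add: lpa_eq_def rel_cong_def)

lemma lpa_eq_add: "p \<approx>\<^bsub>G\<^esub> p' \<Longrightarrow> q \<approx>\<^bsub>G\<^esub> q' \<Longrightarrow> p + q \<approx>\<^bsub>G\<^esub> p' + q'"
  by (simp add: lpa_eq_def rel_cong_add)

lemma lpa_eq_sum:
  "(\<And>i. i \<in> I \<Longrightarrow> p i \<approx>\<^bsub>G\<^esub> q i) \<Longrightarrow> (\<Sum>i \<in> I. p i) \<approx>\<^bsub>G\<^esub> (\<Sum>i \<in> I. q i)"
  by (induction I rule: infinite_finite_induct) (simp_all add: lpa_eq_refl lpa_eq_add)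

lemma lpa_eq_mult: "p \<approx>\<^bsub>G\<^esub> p' \<Longrightarrow> q \<approx>\<^bsub>G\<^esub> q' \<Longrightarrow> p * q \<approx>\<^bsub>G\<^esub> p' * q'"
  by (simp add: lpa_eq_def rel_cong_mult)

lemma lpa_eq_mult_left: "a \<in> lpa_free G \<Longrightarrow> p \<approx>\<^bsub>G\<^esub> q \<Longrightarrow> a * p \<approx>\<^bsub>G\<^esub> a * q"
  by (rule lpa_eq_mult[OF lpa_eq_refl])

lemma lpa_eq_mult_right: "a \<in> lpa_free G \<Longrightarrow> p \<approx>\<^bsub>G\<^esub> q \<Longrightarrow> p * a \<approx>\<^bsub>G\<^esub> q * a"
  by (rule lpa_eq_mult[OF _ lpa_eq_refl])

text \<open>The shape of the path computations below: the two inner factors collapse.\<close>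

lemma lpa_eq_mult_middle:
  "a \<in> lpa_free G \<Longrightarrow> b \<in> lpa_free G \<Longrightarrow> p * q \<approx>\<^bsub>G\<^esub> r \<Longrightarrow> (a * p) * (q * b) \<approx>\<^bsub>G\<^esub> a * (r * b)"
  using lpa_eq_mult_left[OF _ lpa_eq_mult_right, of a G b "p * q" r] by (simp add: mult.assoc)

lemma lpa_gens_simps [simp]:
  "Vertex v \<in> lpa_gens G \<longleftrightarrow> v \<in> verts G"
  "Edge e \<in> lpa_gens G \<longleftrightarrow> e \<in> arcs G"
  "Ghost e \<in> lpa_gens G \<longleftrightarrow> e \<in> arcs G"
  by (auto simp: lpa_gens_def)

lemma lpa_eqI: "p \<in> lpa_free G \<Longrightarrow> q \<in> lpa_free G \<Longrightarrow> p - q \<in> lpa_rels G \<Longrightarrow> p \<approx>\<^bsub>G\<^esub> q"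
  by (simp add: lpa_eq_def rel_cong_def gen_ideal.incl)

lemma lpa_rels_intros:
  "v \<in> verts G \<Longrightarrow> w \<in> verts G \<Longrightarrow>
    vert v * vert w - (if v = w then vert w else 0) \<in> lpa_rels G"
  "e \<in> arcs G \<Longrightarrow> vert (tail G e) * edge e - edge e \<in> lpa_rels G"
  "e \<in> arcs G \<Longrightarrow> edge e * vert (head G e) - edge e \<in> lpa_rels G"
  "e \<in> arcs G \<Longrightarrow> vert (head G e) * ghost e - ghost e \<in> lpa_rels G"
  "e \<in> arcs G \<Longrightarrow> ghost e * vert (tail G e) - ghost e \<in> lpa_rels G"
  "e \<in> arcs G \<Longrightarrow> f \<in> arcs G \<Longrightarrow>
    ghost e * edge f - (if e = f then vert (head G e) else 0) \<in> lpa_rels G"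
  "regular G v \<Longrightarrow> vert v - (\<Sum>e \<in> out_arcs G v. edge e * ghost e) \<in> lpa_rels G"
  unfolding lpa_rels_def by blast+

section \<open>The defining relations as equations\<close>

context
  fixes G :: "('v, 'e) pre_digraph"
  assumes G: "wf_digraph G"
begin

lemma lpa_eq_vert_vert:
  assumes "v \<in> verts G" "w \<in> verts G"
  shows "vert v * vert w \<approx>\<^bsub>G\<^esub> (if v = w then vert w else 0)"
  by (rule lpa_eqI[OF _ _ lpa_rels_intros(1)]) (simp_all add: assms free_algebra_mult)

lemma lpa_eq_edge:
  assumes "e \<in> arcs G"
  shows "vert (tail G e) * edge e \<approx>\<^bsub>G\<^esub> edge e" "edge e * vert (head G e) \<approx>\<^bsub>G\<^esub> edge e"
  using assms wf_digraph.wellformed[OF G assms]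
  by (simp_all add: lpa_eqI lpa_rels_intros free_algebra_mult)

lemma lpa_eq_ghost:
  assumes "e \<in> arcs G"
  shows "vert (head G e) * ghost e \<approx>\<^bsub>G\<^esub> ghost e" "ghost e * vert (tail G e) \<approx>\<^bsub>G\<^esub> ghost e"
  using assms wf_digraph.wellformed[OF G assms]
  by (simp_all add: lpa_eqI lpa_rels_intros free_algebra_mult)

lemma lpa_eq_ghost_edge:
  assumes "e \<in> arcs G" "f \<in> arcs G"
  shows "ghost e * edge f \<approx>\<^bsub>G\<^esub> (if e = f then vert (head G e) else 0)"
  by (rule lpa_eqI[OF _ _ lpa_rels_intros(6)])
    (simp_all add: assms free_algebra_mult wf_digraph.head_in_verts[OF G])

lemma lpa_eq_regular:
  assumes "regular G v"
  shows "vert v \<approx>\<^bsub>G\<^esub> (\<Sum>e \<in> out_arcs G v. edge e * ghost e)"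
  using assms
  by (intro lpa_eqI[OF _ _ lpa_rels_intros(7)] free_algebra_sum free_algebra_mult)
    (simp_all add: regular_def)

end

text \<open>
  Witnesses that the idempotents \<open>v\<close> and \<open>w\<close> of \<open>L\<^sub>K(G)\<close> are Murray--von Neumann equivalent.
\<close>

definition equivalence_pair ::
    "('v, 'e) pre_digraph \<Rightarrow> 'v \<Rightarrow> 'v \<Rightarrow> (('v, 'e) lpa_gen word \<Rightarrow>\<^sub>0 'k::field) \<Rightarrow>
      (('v, 'e) lpa_gen word \<Rightarrow>\<^sub>0 'k) \<Rightarrow> bool" where
  "equivalence_pair G v w p q \<longleftrightarrow>
    p * q \<approx>\<^bsub>G\<^esub> vert v \<and> q * p \<approx>\<^bsub>G\<^esub> vert w \<and>
    vert v * p \<approx>\<^bsub>G\<^esub> p \<and> p * vert w \<approx>\<^bsub>G\<^esub> p \<and> vert w * q \<approx>\<^bsub>G\<^esub> q \<and> q * vert v \<approx>\<^bsub>G\<^esub> q"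

lemma equivalence_pair_sym: "equivalence_pair G v w p q \<Longrightarrow> equivalence_pair G w v q p"
  by (simp add: equivalence_pair_def)

lemma equivalence_pair_vert:
  "wf_digraph G \<Longrightarrow> v \<in> verts G \<Longrightarrow> equivalence_pair G v v (vert v) (vert v)"
  using lpa_eq_vert_vert[of G v v] by (simp add: equivalence_pair_def)

text \<open>If \<open>e\<close> is the only edge leaving its source, that vertex is regular and the
  sum in relation (4) has the single term \<open>edge e * ghost e\<close>. The other product is
  relation (3).\<close>

lemma equivalence_pair_edge:
  assumes "wf_digraph G" "e \<in> arcs G" "out_arcs G (tail G e) = {e}"
  shows "equivalence_pair G (tail G e) (head G e) (edge e) (ghost e)"
proof -
  have "regular G (tail G e)"
    using assms wf_digraph.wellformed[of G e] by (simp add: regular_def)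
  from lpa_eq_sym[OF lpa_eq_regular[OF assms(1) this]] show ?thesis
    using assms lpa_eq_ghost_edge[of G e e]
    by (simp add: equivalence_pair_def lpa_eq_edge lpa_eq_ghost)
qed

text \<open>In either product the inner pair collapses to \<open>vert v\<close>, which is absorbed
  by the factor on its right.\<close>

lemma equivalence_pair_trans:
  assumes "equivalence_pair G u v p q" "equivalence_pair G v w p' q'"
  shows "equivalence_pair G u w (p * p') (q' * q)"
proof -
  note pq = assms[unfolded equivalence_pair_def]
  have free: "p \<in> lpa_free G" "q \<in> lpa_free G" "p' \<in> lpa_free G" "q' \<in> lpa_free G"
    by (rule lpa_eq_free(2), use pq in blast)+
  have "(p * p') * (q' * q) \<approx>\<^bsub>G\<^esub> p * (vert v * q)"
    using pq free by (intro lpa_eq_mult_middle) auto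
  also have "\<dots> \<approx>\<^bsub>G\<^esub> p * q"
    using pq free by (intro lpa_eq_mult_left) auto
  also have "\<dots> \<approx>\<^bsub>G\<^esub> vert u"
    using pq by simp
  finally have 1: "(p * p') * (q' * q) \<approx>\<^bsub>G\<^esub> vert u" .
  have "(q' * q) * (p * p') \<approx>\<^bsub>G\<^esub> q' * (vert v * p')"
    using pq free by (intro lpa_eq_mult_middle) auto
  also have "\<dots> \<approx>\<^bsub>G\<^esub> q' * p'"
    using pq free by (intro lpa_eq_mult_left) auto
  also have "\<dots> \<approx>\<^bsub>G\<^esub> vert w"
    using pq by simp
  finally have 2: "(q' * q) * (p * p') \<approx>\<^bsub>G\<^esub> vert w" .
  have 3: "vert u * p * p' \<approx>\<^bsub>G\<^esub> p * p'" "vert w * q' * q \<approx>\<^bsub>G\<^esub> q' * q"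
    using pq free by (simp_all add: lpa_eq_mult_right)
  have 4: "p * (p' * vert w) \<approx>\<^bsub>G\<^esub> p * p'" "q' * (q * vert u) \<approx>\<^bsub>G\<^esub> q' * q"
    using pq free by (simp_all add: lpa_eq_mult_left)
  show ?thesis
    using 1 2 3 4 by (simp add: equivalence_pair_def mult.assoc)
qed

subsection \<open>Moving the range of an edge\<close>

text \<open>The setting is symmetric in the two graphs, so one construction yields both
  homomorphisms. The pair \<open>p\<close>, \<open>q\<close> uses only common generators: it makes
  sense in both algebras and is fixed by the replacement.\<close>

locale edge_replacement =
  fixes G G' :: "('v, 'e) pre_digraph" and A :: "'e set" and f f' :: 'e
    and p q :: "('v, 'e) lpa_gen word \<Rightarrow>\<^sub>0 'k::field"
  assumes wf: "wf_digraph G" "wf_digraph G'"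
    and verts: "verts G' = verts G"
    and arcs: "arcs G = insert f A" "arcs G' = insert f' A" "f \<notin> A" "f' \<notin> A"
    and incidence: "\<And>e. e \<in> A \<Longrightarrow> tail G' e = tail G e" "\<And>e. e \<in> A \<Longrightarrow> head G' e = head G e"
    and tail: "tail G' f' = tail G f"
    and common: "p \<in> free_algebra (Vertex ` verts G \<union> Edge ` A \<union> Ghost ` A)"
      "q \<in> free_algebra (Vertex ` verts G \<union> Edge ` A \<union> Ghost ` A)"
    and equivalent: "equivalence_pair G (head G' f') (head G f) p q"
      "equivalence_pair G' (head G' f') (head G f) p q"
begin

text \<open>The image of \<open>f\<close> has to lead from the source of \<open>f\<close> to its
  range; \<open>p\<close> links the range of \<open>f'\<close> to that of \<open>f\<close>.\<close>

definition replace :: "('v, 'e) lpa_gen \<Rightarrow> (('v, 'e) lpa_gen word \<Rightarrow>\<^sub>0 'k)" where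
  "replace x =
    (if x = Edge f then edge f' * p else if x = Ghost f then q * ghost f' else gen x)"

lemma replace_simps [simp]:
  "replace (Vertex v) = vert v"
  "replace (Edge f) = edge f' * p"
  "replace (Ghost f) = q * ghost f'"
  "e \<in> A \<Longrightarrow> replace (Edge e) = edge e"
  "e \<in> A \<Longrightarrow> replace (Ghost e) = ghost e"
  using arcs by (auto simp: replace_def)

lemma free:
  "p \<in> lpa_free G" "q \<in> lpa_free G" "p \<in> lpa_free G'" "q \<in> lpa_free G'"
  "edge f \<in> lpa_free G" "ghost f \<in> lpa_free G" "edge f' \<in> lpa_free G'" "ghost f' \<in> lpa_free G'"
proof -
  have "Vertex ` verts G \<union> Edge ` A \<union> Ghost ` A \<subseteq> lpa_gens G"
    "Vertex ` verts G \<union> Edge ` A \<union> Ghost ` A \<subseteq> lpa_gens G'"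
    by (auto simp: arcs verts)
  from this[THEN free_algebra_mono] common
  show "p \<in> lpa_free G" "q \<in> lpa_free G" "p \<in> lpa_free G'" "q \<in> lpa_free G'"
    by blast+
qed (simp_all add: arcs)

lemma subst_replace_common: "subst replace p = p" "subst replace q = q"
  by (rule subst_fixes[OF common(1)] subst_fixes[OF common(2)]; auto)+

lemma gens_cases:
  assumes "x \<in> lpa_gens G"
  obtains v where "v \<in> verts G" "x = Vertex v" | "x = Edge f" | "x = Ghost f"
    | e where "e \<in> A" "x = Edge e" | e where "e \<in> A" "x = Ghost e"
  using assms arcs by (auto simp: lpa_gens_def)

lemma replace_free: "x \<in> lpa_gens G \<Longrightarrow> replace x \<in> lpa_free G'"
  by (erule gens_cases) (auto simp: free free_algebra_mult verts arcs)

section \<open>The relations under replacement\<close>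

lemma replace_edge:
  "vert (tail G f) * (edge f' * p) \<approx>\<^bsub>G'\<^esub> edge f' * p"
  "(edge f' * p) * vert (head G f) \<approx>\<^bsub>G'\<^esub> edge f' * p"
  using lpa_eq_mult_right[OF _ lpa_eq_edge(1)[OF wf(2), of f'], of p]
    equivalent(2) lpa_eq_mult_left[of "edge f'" G' "p * vert (head G f)" p]
  by (simp_all add: equivalence_pair_def tail arcs free mult.assoc)

lemma replace_ghost:
  "vert (head G f) * (q * ghost f') \<approx>\<^bsub>G'\<^esub> q * ghost f'"
  "(q * ghost f') * vert (tail G f) \<approx>\<^bsub>G'\<^esub> q * ghost f'"
  using lpa_eq_mult_left[OF _ lpa_eq_ghost(2)[OF wf(2), of f'], of q]
    equivalent(2) lpa_eq_mult_right[of "ghost f'" G' "vert (head G f) * q" q]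
  by (simp_all add: equivalence_pair_def tail arcs free mult.assoc)

text \<open>Relation (3) for \<open>f\<close>: the inner pair gives the range of \<open>f'\<close>,
  which \<open>p\<close> absorbs, and \<open>q * p\<close> is left.\<close>

lemma replace_ghost_edge: "(q * ghost f') * (edge f' * p) \<approx>\<^bsub>G'\<^esub> vert (head G f)"
proof -
  have "(q * ghost f') * (edge f' * p) \<approx>\<^bsub>G'\<^esub> q * (vert (head G' f') * p)"
    using lpa_eq_ghost_edge[OF wf(2), of f' f'] by (intro lpa_eq_mult_middle) (simp_all add: free arcs)
  also have "\<dots> \<approx>\<^bsub>G'\<^esub> q * p"
    using equivalent(2) by (intro lpa_eq_mult_left) (simp_all add: free arcs equivalence_pair_def)
  also have "\<dots> \<approx>\<^bsub>G'\<^esub> vert (head G f)"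
    using equivalent(2) by (simp add: equivalence_pair_def)
  finally show ?thesis .
qed

text \<open>The summand of \<open>f\<close> in relation (4) turns into that of \<open>f'\<close>, as
  \<open>p * q\<close> is the range of \<open>f'\<close>.\<close>

lemma replace_edge_ghost: "(edge f' * p) * (q * ghost f') \<approx>\<^bsub>G'\<^esub> edge f' * ghost f'"
proof -
  have "(edge f' * p) * (q * ghost f') \<approx>\<^bsub>G'\<^esub> edge f' * (vert (head G' f') * ghost f')"
    using equivalent(2) by (intro lpa_eq_mult_middle) (simp_all add: free arcs equivalence_pair_def)
  also have "\<dots> \<approx>\<^bsub>G'\<^esub> edge f' * ghost f'"
    using lpa_eq_ghost(1)[OF wf(2), of f'] by (intro lpa_eq_mult_left) (simp_all add: free arcs)
  finally show ?thesis .
qed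

text \<open>Since \<open>f\<close> and \<open>f'\<close> share their source, the fibres differ by
  trading one for the other; finiteness and nonemptiness, hence regularity, carry over.\<close>

lemma out_arcs_replace:
  "out_arcs G v = {e \<in> A. tail G e = v} \<union> (if tail G f = v then {f} else {})"
  "out_arcs G' v = {e \<in> A. tail G e = v} \<union> (if tail G f = v then {f'} else {})"
  using arcs incidence tail by auto

lemma replace_regular:
  assumes "regular G v"
  shows "vert v \<approx>\<^bsub>G'\<^esub> (\<Sum>e \<in> out_arcs G v. replace (Edge e) * replace (Ghost e))"
proof -
  let ?B = "{e \<in> A. tail G e = v}"
  have B: "finite ?B" and reg: "regular G' v"
    using assms by (auto simp: regular_def verts out_arcs_replace split: if_splits)
  have "vert v \<approx>\<^bsub>G'\<^esub> (\<Sum>e \<in> out_arcs G' v. edge e * ghost e)"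
    by (rule lpa_eq_regular[OF wf(2) reg])
  also have "\<dots> \<approx>\<^bsub>G'\<^esub> (\<Sum>e \<in> out_arcs G v. replace (Edge e) * replace (Ghost e))"
  proof -
    have B_eq: "(\<Sum>e \<in> ?B. edge e * ghost e) \<approx>\<^bsub>G'\<^esub>
        (\<Sum>e \<in> ?B. replace (Edge e) * replace (Ghost e))"
      using arcs by (intro lpa_eq_sum) (auto intro!: lpa_eq_refl free_algebra_mult)
    show ?thesis
      \<comment> \<open>\<open>B_eq\<close> alone settles the case that \<open>f\<close> does not
        start at \<open>v\<close>; otherwise the summand of \<open>f'\<close> is added.\<close>
      using B_eq arcs(3,4) B lpa_eq_add[OF lpa_eq_sym[OF replace_edge_ghost] B_eq]
      by (simp add: out_arcs_replace)
  qed
  finally show ?thesis .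
qed

lemma replace_rels:
  assumes "r \<in> lpa_rels G"
  shows "subst replace r \<in> gen_ideal (lpa_free G') (lpa_rels G')"
proof -
  \<comment> \<open>Every relation is a difference, so it suffices that the images of its two sides
    are congruent.\<close>
  have *: "subst replace (a - b) \<in> gen_ideal (lpa_free G') (lpa_rels G')"
    if "subst replace a \<approx>\<^bsub>G'\<^esub> subst replace b" for a b
    using that by (simp add: subst_diff lpa_eq_def rel_cong_def)
  have edge: "vert (tail G e) * replace (Edge e) \<approx>\<^bsub>G'\<^esub> replace (Edge e)"
    "replace (Edge e) * vert (head G e) \<approx>\<^bsub>G'\<^esub> replace (Edge e)"
    "vert (head G e) * replace (Ghost e) \<approx>\<^bsub>G'\<^esub> replace (Ghost e)"
    "replace (Ghost e) * vert (tail G e) \<approx>\<^bsub>G'\<^esub> replace (Ghost e)" if "e \<in> arcs G" for e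
    using that lpa_eq_edge[OF wf(2), of e] lpa_eq_ghost[OF wf(2), of e] arcs incidence[of e]
    by (auto simp: replace_edge replace_ghost)
  have ghost_edge: "replace (Ghost e) * replace (Edge g) \<approx>\<^bsub>G'\<^esub>
      (if e = g then vert (head G e) else 0)" if eg: "e \<in> arcs G" "g \<in> arcs G" for e g
  proof -
    \<comment> \<open>In the mixed cases the product vanishes because \<open>f'\<close> differs from
      every edge in \<open>A\<close>; the outer factor \<open>q\<close> or \<open>p\<close> does not
      affect this.\<close>
    consider "e = f" "g = f" | "e = f" "g \<in> A" "g \<noteq> f" | "e \<in> A" "e \<noteq> f" "g = f" | "e \<in> A" "g \<in> A"
      using eg arcs(1,3) by auto
    then show ?thesis
    proof cases
      case 1
      then show ?thesis by (simp add: replace_ghost_edge)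
    next
      case 2
      then have "q * (ghost f' * edge g) \<approx>\<^bsub>G'\<^esub> q * 0"
        using lpa_eq_ghost_edge[OF wf(2), of f' g] arcs
        by (intro lpa_eq_mult_left) (auto simp: free split: if_splits)
      with 2 show ?thesis by (simp add: mult.assoc)
    next
      case 3
      then have "(ghost e * edge f') * p \<approx>\<^bsub>G'\<^esub> 0 * p"
        using lpa_eq_ghost_edge[OF wf(2), of e f'] arcs
        by (intro lpa_eq_mult_right) (auto simp: free split: if_splits)
      with 3 show ?thesis by (simp add: mult.assoc)
    next
      case 4
      then show ?thesis
        using lpa_eq_ghost_edge[OF wf(2), of e g] arcs incidence by auto
    qed
  qed
  show ?thesis
    using assms[unfolded lpa_rels_def]
    by (elim UnE CollectE exE conjE; hypsubst; intro *)
      (use lpa_eq_vert_vert[OF wf(2)] edge ghost_edge replace_regular in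
        \<open>simp_all add: subst_mult subst_sum verts if_distrib[of "subst replace"]
          cong: if_cong split del: if_split\<close>)
qed

text \<open>Exchanging the graphs exchanges \<open>p\<close> and \<open>q\<close>; the inverse
  homomorphism is the replacement of the swapped instance.\<close>

lemma edge_replacement_swap: "edge_replacement G' G A f' f q p"
  using wf verts arcs incidence tail common equivalent
  by (intro edge_replacement.intro) (simp_all add: equivalence_pair_sym)

text \<open>There and back, \<open>f\<close> becomes \<open>f q p\<close> and its ghost
  \<open>q p\<close> times the ghost. Here \<open>q p\<close> is the range of \<open>f\<close>,
  which both absorb.\<close>

lemma replace_replace:
  assumes "x \<in> lpa_gens G"
  shows "subst (edge_replacement.replace f' f q p) (replace x) \<approx>\<^bsub>G\<^esub> gen x"
proof -
  interpret swap: edge_replacement G' G A f' f q p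
    by (rule edge_replacement_swap)
  have "(edge f * q) * p \<approx>\<^bsub>G\<^esub> edge f"
  proof -
    have "edge f * (q * p) \<approx>\<^bsub>G\<^esub> edge f * vert (head G f)"
      using equivalent(1) by (intro lpa_eq_mult_left) (simp_all add: free arcs equivalence_pair_def)
    also have "\<dots> \<approx>\<^bsub>G\<^esub> edge f"
      by (rule lpa_eq_edge[OF wf(1)]) (simp add: arcs)
    finally show ?thesis by (simp add: mult.assoc)
  qed
  moreover have "q * (p * ghost f) \<approx>\<^bsub>G\<^esub> ghost f"
  proof -
    have "(q * p) * ghost f \<approx>\<^bsub>G\<^esub> vert (head G f) * ghost f"
      using equivalent(1) by (intro lpa_eq_mult_right) (simp_all add: free arcs equivalence_pair_def)
    also have "\<dots> \<approx>\<^bsub>G\<^esub> ghost f"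
      by (rule lpa_eq_ghost[OF wf(1)]) (simp add: arcs)
    finally show ?thesis by (simp add: mult.assoc)
  qed
  ultimately show ?thesis
    by (cases rule: gens_cases[OF assms])
      (simp_all add: subst_mult swap.subst_replace_common arcs lpa_eq_refl)
qed

theorem isomorphic:
  "alg_isomorphic (leavitt_path_algebra TYPE('k) G) (leavitt_path_algebra TYPE('k) G')"
proof -
  interpret swap: edge_replacement G' G A f' f q p
    by (rule edge_replacement_swap)
  show ?thesis
    unfolding leavitt_path_algebra_def
    by (rule presented_algebra_isomorphic[OF replace_free swap.replace_free replace_rels
          swap.replace_rels replace_replace[unfolded lpa_eq_def]
          swap.replace_replace[unfolded lpa_eq_def]])
qed

end

subsection \<open>Chains\<close>

text \<open>The path from \<open>v\<^sub>n\<close> down to \<open>v\<^sub>0\<close>. It starts from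
  the vertex, the path of length zero, because the empty word is excluded from the algebra.\<close>

fun chain_path :: "'v \<Rightarrow> nat \<Rightarrow> (('v + nat, 'e + nat) lpa_gen word \<Rightarrow>\<^sub>0 'k::field)" where
  "chain_path v0 0 = vert (Inl v0)"
| "chain_path v0 (Suc i) = edge (Inr (Suc i)) * chain_path v0 i"

fun chain_ghost :: "'v \<Rightarrow> nat \<Rightarrow> (('v + nat, 'e + nat) lpa_gen word \<Rightarrow>\<^sub>0 'k::field)" where
  "chain_ghost v0 0 = vert (Inl v0)"
| "chain_ghost v0 (Suc i) = chain_ghost v0 i * ghost (Inr (Suc i))"

text \<open>Each chain edge is alone in leaving its source, and transitivity composes these pairs.
  Nothing is asked of the edges leaving \<open>v\<^sub>0\<close>, and only the edges numbered 1 to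
  \<open>n\<close> are constrained, so both extensions qualify.\<close>

lemma chain_equivalence_pair:
  fixes G :: "('v + nat, 'e + nat) pre_digraph"
  assumes "wf_digraph G" "Inl v0 \<in> verts G"
    and "\<And>i. 1 \<le> i \<Longrightarrow> i \<le> n \<Longrightarrow> tail G (Inr i) = chain_vertex v0 i"
    and "\<And>i. 1 \<le> i \<Longrightarrow> i \<le> n \<Longrightarrow> head G (Inr i) = chain_vertex v0 (i - 1)"
    and "\<And>i. 1 \<le> i \<Longrightarrow> i \<le> n \<Longrightarrow> out_arcs G (chain_vertex v0 i) = {Inr i}"
  shows "equivalence_pair G (chain_vertex v0 n) (Inl v0)
    (chain_path v0 n :: _ \<Rightarrow>\<^sub>0 'k::field) (chain_ghost v0 n)"
  using assms(3-)
proof (induction n)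
  case 0
  then show ?case
    using assms(1,2) by (simp add: chain_vertex_def equivalence_pair_vert)
next
  case (Suc i)
  have out: "out_arcs G (tail G (Inr (Suc i))) = {Inr (Suc i)}"
    using Suc.prems(1,3)[of "Suc i"] by simp
  then have "Inr (Suc i) \<in> arcs G"
    by (metis out_arcs_in_arcs singletonI)
  from equivalence_pair_edge[OF assms(1) this out]
  have "equivalence_pair G (chain_vertex v0 (Suc i)) (chain_vertex v0 i)
      (edge (Inr (Suc i)) :: _ \<Rightarrow>\<^sub>0 'k) (ghost (Inr (Suc i)))"
    using Suc.prems(1,2)[of "Suc i"] by simp
  moreover have "equivalence_pair G (chain_vertex v0 i) (Inl v0)
      (chain_path v0 i :: _ \<Rightarrow>\<^sub>0 'k) (chain_ghost v0 i)"
    using Suc by simp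
  ultimately show ?case
    by (simp add: equivalence_pair_trans)
qed

lemma chain_free:
  assumes "Inl v0 \<in> V" "Inr ` {1..n} \<subseteq> A"
  shows "chain_path v0 n \<in> free_algebra (Vertex ` V \<union> Edge ` A \<union> Ghost ` A)"
    and "chain_ghost v0 n \<in> free_algebra (Vertex ` V \<union> Edge ` A \<union> Ghost ` A)"
  using assms(2) by (induction n) (auto simp: assms(1) image_subset_iff intro!: free_algebra_mult)

section \<open>The two extensions as an edge replacement\<close>

lemma wf_digraph_vertex_extension:
  "wf_digraph E \<Longrightarrow> v0 \<in> verts E \<Longrightarrow> wf_digraph (vertex_extension E v0 n)"
  by (auto simp: wf_digraph_def vertex_extension_def chain_vertex_def inj_image_mem_iff)

lemma wf_digraph_edge_extension:
  "wf_digraph E \<Longrightarrow> e0 \<in> arcs E \<Longrightarrow> wf_digraph (edge_extension E e0 n)"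
  by (auto simp: wf_digraph_def edge_extension_def inj_image_mem_iff)

theorem lemma3p4:
  fixes E :: "('v, 'e) pre_digraph"
    and e0 :: 'e
    and v0 :: 'v
    and n :: nat
  assumes "wf_digraph E"
    and "row_finite E"
    and "e0 \<in> arcs E"
    and "n > 0"
    and "v0 = head E e0"
  shows "alg_isomorphic
    (leavitt_path_algebra TYPE('k::field) (vertex_extension E v0 n))
    (leavitt_path_algebra TYPE('k) (edge_extension E e0 n))"
proof -
  let ?G = "vertex_extension E v0 n" and ?G' = "edge_extension E e0 n"
  let ?A = "Inl ` (arcs E - {e0}) \<union> Inr ` {1..n} :: ('e + nat) set"
  let ?p = "chain_path v0 n :: ('v + nat, 'e + nat) lpa_gen word \<Rightarrow>\<^sub>0 'k"
  let ?q = "chain_ghost v0 n :: ('v + nat, 'e + nat) lpa_gen word \<Rightarrow>\<^sub>0 'k"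
  have v0: "v0 \<in> verts E"
    using assms wf_digraph.head_in_verts by fastforce
  have wf: "wf_digraph ?G" "wf_digraph ?G'"
    using assms v0 by (simp_all add: wf_digraph_vertex_extension wf_digraph_edge_extension)
  have heads: "head ?G' (Inr (n + 1)) = chain_vertex v0 n" "head ?G (Inl e0) = Inl v0"
    using assms by (simp_all add: vertex_extension_def edge_extension_def chain_vertex_def)
  have pair: "equivalence_pair ?G (chain_vertex v0 n) (Inl v0) ?p ?q"
    using wf v0 by (intro chain_equivalence_pair)
      (auto simp: vertex_extension_def chain_vertex_def out_arcs_def split: if_splits)
  \<comment> \<open>The first chain edge ends in \<open>head E e0\<close>, which is
    \<open>v0\<close>. The edge numbered \<open>n + 1\<close> starts at an old vertex, so it leaves
    no \<open>v\<^sub>i\<close> with \<open>i\<close> from 1 to \<open>n\<close>.\<close>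
  have pair': "equivalence_pair ?G' (chain_vertex v0 n) (Inl v0) ?p ?q"
    using wf v0 assms(5) by (intro chain_equivalence_pair)
      (auto simp: edge_extension_def chain_vertex_def out_arcs_def split: if_splits)
  \<comment> \<open>The common edges \<open>?A\<close> are the old ones other than \<open>e0\<close>
    and the first \<open>n\<close> new ones; \<open>e0\<close> is traded for the new edge numbered
    \<open>n + 1\<close>.\<close>
  have "edge_replacement ?G ?G' ?A (Inl e0) (Inr (n + 1)) ?p ?q"
  proof (rule edge_replacement.intro)
    show "?p \<in> free_algebra (Vertex ` verts ?G \<union> Edge ` ?A \<union> Ghost ` ?A)"
      "?q \<in> free_algebra (Vertex ` verts ?G \<union> Edge ` ?A \<union> Ghost ` ?A)"
      using v0 by (auto intro!: chain_free simp: vertex_extension_def)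
  qed (use assms wf pair pair' heads in
      \<open>auto simp: vertex_extension_def edge_extension_def chain_vertex_def\<close>)
  then show ?thesis
    by (rule edge_replacement.isomorphic)
qed

end
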